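(* Let $R$ be a ring. Then the following are equivalent: (1) $R$ is uniquely $\pi$-clean. (2) For any $a\in R$, there exist an $m\in\mathbb{N}$ and a central idempotent $e\in R$ such that $a^m-e\in J(R)$.
   Context: All rings are associative with identity, not necessarily commutative. $\mathbb{N}$ denotes the positive integers, $J(R)$ the Jacobson radical of $R$. An element $x$ of a ring $R$ is uniquely clean if it can be written in exactly one way as $x=e+u$ with $e\in R$ an idempotent and $u\in R$ a unit. A ring $R$ is uniquely $\pi$-clean if for every $a\in R$ there exists $n\in\mathbb{N}$ such that $a^n$ is uniquely clean. *)

theory Defs
  imports "HOL-Algebra.Ideal"
begin

(* HOL-Algebra's "ring" is associative and unital, not necessarily commutative, and
   includes the zero ring; its ideals are two-sided, so left ideals are defined here. *)

locale left_ideal = additive_subgroup I R + ring R for I and R (structure) +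
  assumes l_closed: "\<lbrakk>a \<in> I; x \<in> carrier R\<rbrakk> \<Longrightarrow> x \<otimes> a \<in> I"

locale maximal_left_ideal = left_ideal +
  assumes I_proper: "carrier R \<noteq> I"
    and I_maximal: "\<lbrakk>left_ideal J R; I \<subseteq> J; J \<subseteq> carrier R\<rbrakk> \<Longrightarrow> J = I \<or> J = carrier R"

(* The guard "carrier R" makes the empty intersection (zero ring) equal to R. *)
definition jacobson_radical :: "('a, 'b) ring_scheme \<Rightarrow> 'a set"
  where "jacobson_radical R = carrier R \<inter> \<Inter> {I. maximal_left_ideal I R}"

definition idempotents :: "('a, 'b) ring_scheme \<Rightarrow> 'a set"
  where "idempotents R = {e \<in> carrier R. e \<otimes>\<^bsub>R\<^esub> e = e}"

definition central :: "('a, 'b) ring_scheme \<Rightarrow> 'a \<Rightarrow> bool"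
  where "central R c \<longleftrightarrow> c \<in> carrier R \<and> (\<forall>x \<in> carrier R. c \<otimes>\<^bsub>R\<^esub> x = x \<otimes>\<^bsub>R\<^esub> c)"

(* What is unique is the pair (e, u), not e and u one after the other. *)
definition uniquely_clean :: "('a, 'b) ring_scheme \<Rightarrow> 'a \<Rightarrow> bool"
  where "uniquely_clean R x \<longleftrightarrow>
    x \<in> carrier R \<and> (\<exists>!p. p \<in> idempotents R \<times> Units R \<and> x = fst p \<oplus>\<^bsub>R\<^esub> snd p)"

definition uniquely_pi_clean :: "('a, 'b) ring_scheme \<Rightarrow> bool"
  where "uniquely_pi_clean R \<longleftrightarrow>
    (\<forall>a \<in> carrier R. \<exists>n::nat. n > 0 \<and> uniquely_clean R (a [^]\<^bsub>R\<^esub> n))"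

end

theory Submission
  imports Defs
begin

text \<open>
  Both conditions force all idempotents to be central, and then one-sided inverses are two-sided.
  If \<open>x = e + u\<close> is uniquely clean, put \<open>d = x - (1 - e)\<close>. For \<open>r\<close> in the ring
  write a power of \<open>y = 1 - r d\<close> as \<open>g + w\<close>. On the corner \<open>g R\<close> the element \<open>1 - y = r d\<close>
  is invertible, hence so is \<open>d\<close>, and replacing \<open>e\<close> by \<open>1 - e\<close> on this corner yields another clean
  decomposition of \<open>x\<close>. Uniqueness gives \<open>g = 0\<close>, so \<open>y\<close> is left invertible and \<open>d\<close> lies in the
  radical. Conversely, if \<open>x - e\<close> lies in the radical, \<open>x = (1 - e) + (x - (1 - e))\<close> is clean, and
  for any other decomposition \<open>x = f + u\<close> the idempotents \<open>e f\<close> and \<open>(1 - e) (1 - f)\<close> lie in the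
  radical, so they vanish.
\<close>

section \<open>The Jacobson radical\<close>

text \<open>Negation is left multiplication by \<open>\<ominus> \<one>\<close>, so closure under
  negatives follows from the absorption clause.\<close>

lemma (in ring) left_ideal_iff:
  "left_ideal I R \<longleftrightarrow> I \<subseteq> carrier R \<and> \<zero> \<in> I \<and> (\<forall>a\<in>I. \<forall>b\<in>I. a \<oplus> b \<in> I) \<and>
     (\<forall>a\<in>I. \<forall>x\<in>carrier R. x \<otimes> a \<in> I)" (is "_ \<longleftrightarrow> ?P")
proof
  assume "left_ideal I R"
  then interpret left_ideal I R .
  show ?P using a_subset zero_closed a_closed l_closed by blast
next
  assume P: ?P
  have inv: "\<ominus> a \<in> I" if "a \<in> I" for a
  proof -
    have "a \<in> carrier R" using P that by blast
    then have "(\<ominus> \<one>) \<otimes> a = \<ominus> a" by (simp add: l_minus)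
    moreover have "(\<ominus> \<one>) \<otimes> a \<in> I" using P that by blast
    ultimately show ?thesis by simp
  qed
  have "additive_subgroup I R"
    using P inv by (intro additive_subgroupI add.subgroupI) (auto simp: a_inv_def)
  then show "left_ideal I R"
    using P by (intro left_ideal.intro left_ideal_axioms.intro ring_axioms) auto
qed

lemma (in ring) left_ideal_eq_carrier:
  assumes "left_ideal I R" "\<one> \<in> I"
  shows "I = carrier R"
  using assms unfolding left_ideal_iff by (metis r_one subsetI subset_antisym)

text \<open>A left ideal is proper exactly when it omits \<open>\<one>\<close>. In this form
  properness passes to unions of nonempty chains, as Zorn's lemma requires.\<close>

lemma (in ring) maximal_left_ideal_iff:
  "maximal_left_ideal I R \<longleftrightarrow> left_ideal I R \<and> \<one> \<notin> I \<and>
     (\<forall>J. left_ideal J R \<and> I \<subseteq> J \<and> \<one> \<notin> J \<longrightarrow> J = I)"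
proof -
  have one: "\<one> \<in> J \<longleftrightarrow> J = carrier R" if "left_ideal J R" for J
    using left_ideal_eq_carrier[OF that] by auto
  have sub: "J \<subseteq> carrier R" if "left_ideal J R" for J
    using that left_ideal_iff by simp
  show ?thesis
  proof
    assume M: "maximal_left_ideal I R"
    then have I: "left_ideal I R" by (rule maximal_left_ideal.axioms)
    have "J = I" if "left_ideal J R" "I \<subseteq> J" "\<one> \<notin> J" for J
      using maximal_left_ideal.I_maximal[OF M that(1,2) sub[OF that(1)]] one[OF that(1)] that(3)
      by simp
    with I one[OF I] maximal_left_ideal.I_proper[OF M]
    show "left_ideal I R \<and> \<one> \<notin> I \<and> (\<forall>J. left_ideal J R \<and> I \<subseteq> J \<and> \<one> \<notin> J \<longrightarrow> J = I)"
      by simp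
  next
    assume *: "left_ideal I R \<and> \<one> \<notin> I \<and> (\<forall>J. left_ideal J R \<and> I \<subseteq> J \<and> \<one> \<notin> J \<longrightarrow> J = I)"
    then have I: "left_ideal I R" and "\<one> \<notin> I" by simp_all
    then have "carrier R \<noteq> I" using one[OF I] by simp
    moreover have "J = I \<or> J = carrier R" if "left_ideal J R" "I \<subseteq> J" for J
      using * that one[OF that(1)] by blast
    ultimately show "maximal_left_ideal I R"
      by (intro maximal_left_ideal.intro maximal_left_ideal_axioms.intro I) simp_all
  qed
qed

lemma (in ring) exists_maximal_left_ideal:
  assumes I: "left_ideal I R" "\<one> \<notin> I"
  shows "\<exists>M. maximal_left_ideal M R \<and> I \<subseteq> M"
proof -
  let ?A = "{J. left_ideal J R \<and> I \<subseteq> J \<and> \<one> \<notin> J}"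
  have "\<exists>M\<in>?A. \<forall>X\<in>?A. M \<subseteq> X \<longrightarrow> X = M"
  proof (rule subset_Zorn_nonempty)
    show "?A \<noteq> {}" using I by blast
    fix C assume C: "C \<noteq> {}" "subset.chain ?A C"
    then have CA: "C \<subseteq> ?A" and lin: "\<And>X Y. X \<in> C \<Longrightarrow> Y \<in> C \<Longrightarrow> X \<subseteq> Y \<or> Y \<subseteq> X"
      by (auto simp: subset_chain_def)
    have li: "left_ideal X R" if "X \<in> C" for X using CA that by blast
    have "a \<oplus> b \<in> \<Union>C" if ab: "a \<in> \<Union>C" "b \<in> \<Union>C" for a b
    proof -
      \<comment> \<open>The chain is totally ordered, so the larger of the two members holding
        \<open>a\<close> and \<open>b\<close> holds both.\<close>
      obtain Z where "Z \<in> C" "a \<in> Z" "b \<in> Z" using ab lin by blast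
      then show ?thesis using li unfolding left_ideal_iff by blast
    qed
    then have "left_ideal (\<Union>C) R"
      unfolding left_ideal_iff using li[unfolded left_ideal_iff] C(1) by blast
    then show "\<Union>C \<in> ?A" using CA C(1) by blast
  qed
  then obtain M where M: "M \<in> ?A" "\<forall>X\<in>?A. M \<subseteq> X \<longrightarrow> X = M" by (rule bexE)
  have "X = M" if "left_ideal X R" "M \<subseteq> X" "\<one> \<notin> X" for X
  proof -
    have "X \<in> ?A" using M(1) that by auto
    with M(2) that(2) show ?thesis by simp
  qed
  then have "maximal_left_ideal M R" using M(1) unfolding maximal_left_ideal_iff by simp
  with M(1) show ?thesis by auto
qed

text \<open>Needed for two instances: \<open>I\<close> zero gives the principal left ideal of
  \<open>d\<close>, and \<open>I\<close> maximal gives the enlargement of \<open>I\<close> by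
  \<open>d\<close>.\<close>

lemma (in ring) left_ideal_add_multiples:
  assumes I: "left_ideal I R" and d: "d \<in> carrier R"
  shows "left_ideal {i \<oplus> r \<otimes> d |i r. i \<in> I \<and> r \<in> carrier R} R" (is "left_ideal ?K R")
proof -
  note I' = I[unfolded left_ideal_iff]
  have sub: "i \<in> carrier R" if "i \<in> I" for i using I' that by blast
  have zero: "\<zero> \<in> ?K"
  proof -
    have "\<zero> = \<zero> \<oplus> \<zero> \<otimes> d" using d by simp
    then show ?thesis using I' by blast
  qed
  have add: "a \<oplus> b \<in> ?K" if ab: "a \<in> ?K" "b \<in> ?K" for a b
  proof -
    obtain i r j s where *: "a = i \<oplus> r \<otimes> d" "b = j \<oplus> s \<otimes> d" "i \<in> I" "j \<in> I"
      "r \<in> carrier R" "s \<in> carrier R" using ab by blast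
    then have "a \<oplus> b = (i \<oplus> j) \<oplus> (r \<oplus> s) \<otimes> d" using d sub by (simp add: l_distr a_ac)
    then show ?thesis using * I' by blast
  qed
  have mult: "x \<otimes> a \<in> ?K" if ax: "a \<in> ?K" "x \<in> carrier R" for a x
  proof -
    obtain i r where *: "a = i \<oplus> r \<otimes> d" "i \<in> I" "r \<in> carrier R" using ax by blast
    then have "x \<otimes> a = x \<otimes> i \<oplus> (x \<otimes> r) \<otimes> d" using d sub ax by (simp add: r_distr m_assoc)
    then show ?thesis using * I' ax by blast
  qed
  have "?K \<subseteq> carrier R" using d sub by auto
  then show ?thesis unfolding left_ideal_iff by (intro conjI ballI zero add mult)
qed

text \<open>If \<open>1 - r d\<close> has no left inverse, a maximal left ideal contains it; as
  \<open>r d\<close> lies there too, so does their sum 1. Conversely, if \<open>d\<close> is outside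
  a maximal \<open>M\<close>, then \<open>M + R d\<close> is everything, and 1 =
  \<open>i + r d\<close> makes \<open>1 - r d\<close> a left invertible element of
  \<open>M\<close>.\<close>

lemma (in ring) jacobson_radical_iff:
  "d \<in> jacobson_radical R \<longleftrightarrow>
     d \<in> carrier R \<and> (\<forall>r\<in>carrier R. \<exists>t\<in>carrier R. t \<otimes> (\<one> \<ominus> r \<otimes> d) = \<one>)"
proof
  assume dJ: "d \<in> jacobson_radical R"
  then have d: "d \<in> carrier R" and dM: "\<And>M. maximal_left_ideal M R \<Longrightarrow> d \<in> M"
    by (auto simp: jacobson_radical_def)
  have "\<exists>t\<in>carrier R. t \<otimes> (\<one> \<ominus> r \<otimes> d) = \<one>" if r: "r \<in> carrier R" for r
  proof (rule ccontr)
    assume no: "\<not> ?thesis"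
    define y where "y = \<one> \<ominus> r \<otimes> d"
    have y: "y \<in> carrier R" using r d by (simp add: y_def)
    have zero: "left_ideal {\<zero>} R" unfolding left_ideal_iff by simp
    \<comment> \<open>This is the principal left ideal \<open>R y\<close>; it is proper because
      \<open>y\<close> has no left inverse.\<close>
    let ?K = "{i \<oplus> t \<otimes> y |i t. i \<in> {\<zero>} \<and> t \<in> carrier R}"
    have "left_ideal ?K R" by (rule left_ideal_add_multiples[OF zero y])
    moreover have "\<one> \<notin> ?K"
    proof
      assume "\<one> \<in> ?K"
      then obtain t where t: "t \<in> carrier R" "\<one> = \<zero> \<oplus> t \<otimes> y" by blast
      then have "t \<otimes> y = \<one>" using y by simp
      with no t(1) show False unfolding y_def by blast
    qed
    ultimately obtain M where M: "maximal_left_ideal M R" "?K \<subseteq> M"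
      using exists_maximal_left_ideal by blast
    have one: "\<one> \<notin> M" and li: "left_ideal M R"
      using M(1) by (auto simp: maximal_left_ideal_iff)
    have closed: "\<And>a b. a \<in> M \<Longrightarrow> b \<in> M \<Longrightarrow> a \<oplus> b \<in> M"
      "\<And>a x. a \<in> M \<Longrightarrow> x \<in> carrier R \<Longrightarrow> x \<otimes> a \<in> M"
      using li by (auto simp: left_ideal_iff)
    have "y = \<zero> \<oplus> \<one> \<otimes> y" using y by simp
    then have "y \<in> M" using M(2) by blast
    moreover have "r \<otimes> d \<in> M" using closed dM[OF M(1)] r by blast
    ultimately have "y \<oplus> r \<otimes> d \<in> M" by (rule closed)
    moreover have "y \<oplus> r \<otimes> d = \<one>" using r d by (simp add: y_def a_minus_def a_assoc l_neg)
    ultimately show False using one by simp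
  qed
  with d show "d \<in> carrier R \<and> (\<forall>r\<in>carrier R. \<exists>t\<in>carrier R. t \<otimes> (\<one> \<ominus> r \<otimes> d) = \<one>)" by blast
next
  assume *: "d \<in> carrier R \<and> (\<forall>r\<in>carrier R. \<exists>t\<in>carrier R. t \<otimes> (\<one> \<ominus> r \<otimes> d) = \<one>)"
  then have d: "d \<in> carrier R" by blast
  have "d \<in> M" if M: "maximal_left_ideal M R" for M
  proof (rule ccontr)
    assume dM: "d \<notin> M"
    let ?K = "{i \<oplus> r \<otimes> d |i r. i \<in> M \<and> r \<in> carrier R}"
    have li: "left_ideal M R" and one: "\<one> \<notin> M"
      and max: "\<And>J. left_ideal J R \<Longrightarrow> M \<subseteq> J \<Longrightarrow> \<one> \<notin> J \<Longrightarrow> J = M"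
      using M unfolding maximal_left_ideal_iff by blast+
    have sub: "M \<subseteq> carrier R" and zero: "\<zero> \<in> M"
      and closed: "\<And>a x. a \<in> M \<Longrightarrow> x \<in> carrier R \<Longrightarrow> x \<otimes> a \<in> M"
      using li unfolding left_ideal_iff by blast+
    have MK: "M \<subseteq> ?K"
    proof
      fix i assume i: "i \<in> M"
      then have "i \<in> carrier R" using sub by blast
      then have "i = i \<oplus> \<zero> \<otimes> d" using d by simp
      with i show "i \<in> ?K" by blast
    qed
    have dK: "d \<in> ?K"
    proof -
      have "d = \<zero> \<oplus> \<one> \<otimes> d" using d by simp
      then show ?thesis using zero by blast
    qed
    have "\<one> \<in> ?K"
    proof (rule ccontr)
      assume "\<one> \<notin> ?K"
      from max[OF left_ideal_add_multiples[OF li d] MK this] dK have "d \<in> M" by (rule subst)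
      with dM show False ..
    qed
    then obtain i r where ir: "\<one> = i \<oplus> r \<otimes> d" "i \<in> M" "r \<in> carrier R" by blast
    then have "i \<in> carrier R" using sub by blast
    then have "\<one> \<ominus> r \<otimes> d = i" using ir d by (simp add: a_minus_def a_assoc r_neg)
    then obtain t where "t \<in> carrier R" "t \<otimes> i = \<one>" using * ir(3) by metis
    then show False using one closed ir by metis
  qed
  then show "d \<in> jacobson_radical R" using d by (auto simp: jacobson_radical_def)
qed

text \<open>A left inverse \<open>t\<close> of \<open>1 - h\<close> gives
  \<open>h = t (1 - h) h = 0\<close>. Asking for \<open>h\<close> as a left multiple of
  \<open>j\<close> lets the criterion apply directly, with no appeal to closure of the radical under
  multiplication.\<close>

lemma (in ring) idempotent_in_jacobson_radical:
  assumes h: "h \<in> idempotents R" and j: "j \<in> jacobson_radical R"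
    and r: "r \<in> carrier R" and hr: "h = r \<otimes> j"
  shows "h = \<zero>"
proof -
  have hc: "h \<in> carrier R" and hh: "h \<otimes> h = h" using h by (auto simp: idempotents_def)
  obtain t where t: "t \<in> carrier R" "t \<otimes> (\<one> \<ominus> h) = \<one>"
    using j r unfolding jacobson_radical_iff hr by blast
  have "h = t \<otimes> (\<one> \<ominus> h) \<otimes> h" using t hc by simp
  also have "\<dots> = t \<otimes> ((\<one> \<ominus> h) \<otimes> h)" using t(1) hc by (simp add: m_assoc)
  also have "(\<one> \<ominus> h) \<otimes> h = \<zero>" using hc hh by (simp add: a_minus_def l_distr l_minus r_neg)
  finally show ?thesis using t by simp
qed

text \<open>Complements \<open>r_neg1\<close> and \<open>r_neg2\<close> when the ordering of sums
  puts a term between an element and its negative.\<close>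

lemma (in ring) add_cancel_middle:
  assumes "a \<in> carrier R" "b \<in> carrier R"
  shows "a \<oplus> (b \<oplus> \<ominus> a) = b" "\<ominus> a \<oplus> (b \<oplus> a) = b"
  using assms by (simp_all add: a_comm[of b] r_neg1 r_neg2)

section \<open>Central idempotents\<close>

lemma (in ring) one_minus_idempotent:
  assumes "e \<in> idempotents R"
  shows "\<one> \<ominus> e \<in> idempotents R" "e \<otimes> (\<one> \<ominus> e) = \<zero>" "(\<one> \<ominus> e) \<otimes> e = \<zero>" "e \<oplus> (\<one> \<ominus> e) = \<one>"
proof -
  have e: "e \<in> carrier R" "e \<otimes> e = e" using assms by (auto simp: idempotents_def)
  show 1: "e \<otimes> (\<one> \<ominus> e) = \<zero>" "(\<one> \<ominus> e) \<otimes> e = \<zero>"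
    using e by (simp_all add: a_minus_def l_distr r_distr l_minus r_minus r_neg)
  have "(\<one> \<ominus> e) \<otimes> (\<one> \<ominus> e) = (\<one> \<ominus> e) \<ominus> e \<otimes> (\<one> \<ominus> e)"
    using e by (simp add: a_minus_def l_distr l_minus)
  then have "(\<one> \<ominus> e) \<otimes> (\<one> \<ominus> e) = \<one> \<ominus> e" using e 1 by (simp add: a_minus_def)
  then show "\<one> \<ominus> e \<in> idempotents R" using e by (simp add: idempotents_def)
  have "e \<oplus> (\<one> \<oplus> \<ominus> e) = \<one> \<oplus> (e \<oplus> \<ominus> e)" using e by (simp add: a_ac)
  then show "e \<oplus> (\<one> \<ominus> e) = \<one>" using e by (simp add: a_minus_def r_neg)
qed

lemma (in ring) central_one_minus:
  assumes "central R e"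
  shows "central R (\<one> \<ominus> e)"
  using assms by (auto simp: central_def a_minus_def l_distr r_distr l_minus r_minus)

lemma (in ring) idempotent_nat_pow:
  assumes "e \<in> idempotents R" "n > 0"
  shows "e [^] (n::nat) = e"
  using assms(2)
proof (induction n rule: nat_induct_non_zero)
  case 1
  then show ?case using assms by (simp add: idempotents_def)
next
  case (Suc n)
  then show ?case using assms by (simp add: idempotents_def)
qed

text \<open>A central idempotent \<open>g\<close> splits the ring as the product of its corners at
  \<open>g\<close> and \<open>1 - g\<close>, where multiplication is componentwise.\<close>

lemma (in ring) corner_mult:
  assumes g: "g \<in> idempotents R" "central R g"
    and c: "x \<in> carrier R" "x' \<in> carrier R" "y \<in> carrier R" "y' \<in> carrier R"
  shows "(x \<otimes> g \<oplus> y \<otimes> (\<one> \<ominus> g)) \<otimes> (x' \<otimes> g \<oplus> y' \<otimes> (\<one> \<ominus> g)) =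
    (x \<otimes> x') \<otimes> g \<oplus> (y \<otimes> y') \<otimes> (\<one> \<ominus> g)"
proof -
  define k where "k = \<one> \<ominus> g"
  have gc: "g \<in> carrier R" and kc: "k \<in> carrier R" using g by (auto simp: idempotents_def k_def)
  note k = one_minus_idempotent[OF g(1), folded k_def] central_one_minus[OF g(2), folded k_def]
  have swap: "(p \<otimes> a) \<otimes> (q \<otimes> b) = (p \<otimes> q) \<otimes> (a \<otimes> b)"
    if "central R a" "p \<in> carrier R" "q \<in> carrier R" "b \<in> carrier R" for p a q b
  proof -
    have a: "a \<in> carrier R" "a \<otimes> q = q \<otimes> a" using that by (auto simp: central_def)
    have "(p \<otimes> a) \<otimes> (q \<otimes> b) = p \<otimes> (a \<otimes> q) \<otimes> b" using that a(1) by (simp add: m_assoc)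
    then show ?thesis using that a by (simp add: m_assoc)
  qed
  show ?thesis unfolding k_def[symmetric]
    using g(1) k gc kc c
    by (simp add: l_distr r_distr swap[OF g(2)] swap[OF k(5)] idempotents_def)
qed

lemma (in ring) corner_split:
  assumes "g \<in> idempotents R" "x \<in> carrier R"
  shows "x \<otimes> g \<oplus> x \<otimes> (\<one> \<ominus> g) = x"
  using assms one_minus_idempotent(4)[OF assms(1)]
  by (simp add: idempotents_def r_distr[symmetric])

text \<open>The element \<open>b a\<close> is idempotent, hence central, so
  \<open>b a = (b a a) b = a (b a) b = (a b) (a b)\<close>, which is 1.\<close>

lemma (in ring) left_invertible_imp_unit:
  assumes abel: "\<And>f. f \<in> idempotents R \<Longrightarrow> central R f"
    and a: "a \<in> carrier R" and b: "b \<in> carrier R" and ab: "a \<otimes> b = \<one>"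
  shows "b \<in> Units R"
proof -
  have idem: "b \<otimes> a \<in> idempotents R"
  proof -
    have "b \<otimes> a \<otimes> (b \<otimes> a) = b \<otimes> (a \<otimes> b) \<otimes> a" using a b by (simp add: m_assoc)
    then show ?thesis using a b ab by (simp add: idempotents_def)
  qed
  have "b \<otimes> a = b \<otimes> a \<otimes> (a \<otimes> b)" using a b ab by simp
  also have "\<dots> = (b \<otimes> a \<otimes> a) \<otimes> b" using a b by (simp add: m_assoc)
  also have "b \<otimes> a \<otimes> a = a \<otimes> (b \<otimes> a)" using abel[OF idem] a by (simp add: central_def)
  also have "a \<otimes> (b \<otimes> a) \<otimes> b = (a \<otimes> b) \<otimes> (a \<otimes> b)" using a b by (simp add: m_assoc)
  finally have "b \<otimes> a = \<one>" using ab by simp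
  then show ?thesis using a b ab by (auto simp: Units_def)
qed

text \<open>The factor is the geometric sum of \<open>y\<close>, built up by splitting off
  \<open>y^k (y - 1)\<close>.\<close>

lemma (in ring) power_minus_one_left_multiple:
  assumes y: "y \<in> carrier R"
  shows "\<exists>s\<in>carrier R. y [^] (k::nat) \<ominus> \<one> = s \<otimes> (y \<ominus> \<one>)"
proof (induction k)
  case 0
  show ?case by (rule bexI[of _ \<zero>]) (use y in \<open>auto simp: a_minus_def r_neg\<close>)
next
  case (Suc k)
  then obtain s where s: "s \<in> carrier R" "y [^] k \<ominus> \<one> = s \<otimes> (y \<ominus> \<one>)" by blast
  have "y [^] Suc k \<ominus> \<one> = y [^] k \<otimes> (y \<ominus> \<one>) \<oplus> (y [^] k \<ominus> \<one>)"
    using y by (simp add: a_minus_def r_distr r_minus a_assoc r_neg2 r_neg1)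
  also have "\<dots> = (y [^] k \<oplus> s) \<otimes> (y \<ominus> \<one>)" using y s by (simp add: l_distr)
  finally show ?case using s y by blast
qed

section \<open>Uniquely clean elements\<close>

lemma (in ring) uniquely_cleanD:
  assumes "uniquely_clean R x" "e \<in> idempotents R" "u \<in> Units R" "x = e \<oplus> u"
    "f \<in> idempotents R" "v \<in> Units R" "x = f \<oplus> v"
  shows "e = f"
proof -
  have "\<exists>!p. p \<in> idempotents R \<times> Units R \<and> x = fst p \<oplus> snd p"
    using assms(1) by (simp add: uniquely_clean_def)
  then have "(e, u) = (f, v)" using assms(2-) by (elim ex1E) (metis SigmaI fst_conv snd_conv)
  then show ?thesis by simp
qed

text \<open>Perturbing \<open>e = (1 - e) + (2 e - 1)\<close> by the square-zero element \<open>e x (1 - e)\<close>, or by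
  \<open>(1 - e) x e\<close>, gives again a clean decomposition.\<close>

lemma (in ring) uniquely_clean_idempotent_perturbation:
  assumes e: "e \<in> idempotents R" and uc: "uniquely_clean R e"
    and z: "z \<in> carrier R" "z \<otimes> z = \<zero>"
      "e \<otimes> z = z \<and> z \<otimes> e = \<zero> \<or> e \<otimes> z = \<zero> \<and> z \<otimes> e = z"
  shows "z = \<zero>"
proof -
  define k where "k = \<one> \<ominus> e"
  note k = one_minus_idempotent[OF e, folded k_def]
  have ec: "e \<in> carrier R" "e \<otimes> e = e" and kc: "k \<in> carrier R" "k \<otimes> k = k"
    using e k by (auto simp: idempotents_def)
  have kz: "k \<otimes> z = z \<ominus> e \<otimes> z" "z \<otimes> k = z \<ominus> z \<otimes> e"
    using ec z by (simp_all add: k_def a_minus_def l_distr r_distr l_minus r_minus)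
  have kz': "e \<otimes> z = z \<and> z \<otimes> e = \<zero> \<and> k \<otimes> z = \<zero> \<and> z \<otimes> k = z \<or>
      e \<otimes> z = \<zero> \<and> z \<otimes> e = z \<and> k \<otimes> z = z \<and> z \<otimes> k = \<zero>"
    using z kz by (auto simp: a_minus_def r_neg)
  \<comment> \<open>Stated for general \<open>w\<close> so that it covers both \<open>z\<close> and
    zero. Since \<open>k w + w k = w\<close> and \<open>w w = 0\<close>, the element
    \<open>k + w\<close> is idempotent.\<close>
  have decomp: "e = (k \<oplus> w) \<oplus> (e \<ominus> k \<ominus> w) \<and> k \<oplus> w \<in> idempotents R \<and> e \<ominus> k \<ominus> w \<in> Units R"
    if w: "w \<in> carrier R" "w \<otimes> w = \<zero>" "e \<otimes> w = w \<and> w \<otimes> e = \<zero> \<and> k \<otimes> w = \<zero> \<and> w \<otimes> k = w \<or>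
      e \<otimes> w = \<zero> \<and> w \<otimes> e = w \<and> k \<otimes> w = w \<and> w \<otimes> k = \<zero>" for w
  proof (intro conjI)
    have "(k \<oplus> w) \<oplus> (e \<oplus> (\<ominus> k \<oplus> \<ominus> w)) = e \<oplus> ((k \<oplus> w) \<oplus> \<ominus> (k \<oplus> w))"
      using ec kc w(1) by (simp add: a_ac minus_add)
    then show "e = (k \<oplus> w) \<oplus> (e \<ominus> k \<ominus> w)"
      using ec kc w(1) by (simp add: a_minus_def r_neg a_assoc)
    have "(k \<oplus> w) \<otimes> (k \<oplus> w) = k \<oplus> w"
      using kc w by (auto simp: l_distr r_distr)
    then show "k \<oplus> w \<in> idempotents R" using kc w by (simp add: idempotents_def)
    \<comment> \<open>As \<open>w\<close> anticommutes with \<open>e - k\<close>, the cross terms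
      cancel; the square is \<open>e + k\<close>, which is 1, so the element is its own
      inverse.\<close>
    have "(e \<ominus> k \<ominus> w) \<otimes> (e \<ominus> k \<ominus> w) = e \<oplus> k"
      using ec kc k w by (auto simp: a_minus_def l_distr r_distr l_minus r_minus
          a_assoc r_neg r_neg1 r_neg2 add_cancel_middle l_neg minus_add)
    then show "e \<ominus> k \<ominus> w \<in> Units R" using k ec kc w by (auto simp: Units_def)
  qed
  have d0: "e = (k \<oplus> \<zero>) \<oplus> (e \<ominus> k \<ominus> \<zero>) \<and> k \<oplus> \<zero> \<in> idempotents R \<and> e \<ominus> k \<ominus> \<zero> \<in> Units R"
    by (rule decomp) (use ec kc in auto)
  have "k \<oplus> z = k \<oplus> \<zero>"
    using uniquely_cleanD[OF uc] decomp[OF z(1,2) kz'] d0 by blast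
  then show ?thesis using kc z by simp
qed

text \<open>The off-diagonal Peirce components \<open>e x (1 - e)\<close> and
  \<open>(1 - e) x e\<close> are square-zero and must vanish, so \<open>e x\<close> and
  \<open>x e\<close> both equal \<open>e x e\<close>.\<close>

lemma (in ring) uniquely_clean_idempotent_central:
  assumes e: "e \<in> idempotents R" and uc: "uniquely_clean R e"
  shows "central R e"
proof -
  define k where "k = \<one> \<ominus> e"
  note k = one_minus_idempotent[OF e, folded k_def]
  have ec: "e \<in> carrier R" "e \<otimes> e = e" and kc: "k \<in> carrier R" "k \<otimes> k = k"
    using e k by (auto simp: idempotents_def)
  have ass: "e \<otimes> (e \<otimes> v) = e \<otimes> v" "e \<otimes> (k \<otimes> v) = \<zero>" "k \<otimes> (e \<otimes> v) = \<zero>"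
    if "v \<in> carrier R" for v
    using ec kc k that by (simp_all add: m_assoc[symmetric])
  have "e \<otimes> x = x \<otimes> e" if x: "x \<in> carrier R" for x
  proof -
    have "e \<otimes> (x \<otimes> k) = \<zero>"
      by (rule uniquely_clean_idempotent_perturbation[OF e uc])
        (use ec kc k x ass in \<open>auto simp: m_assoc\<close>)
    moreover have "k \<otimes> (x \<otimes> e) = \<zero>"
      by (rule uniquely_clean_idempotent_perturbation[OF e uc])
        (use ec kc k x ass in \<open>auto simp: m_assoc\<close>)
    moreover have "e \<otimes> x = e \<otimes> (x \<otimes> e) \<oplus> e \<otimes> (x \<otimes> k)"
      using corner_split[OF e x] ec kc x by (simp add: k_def r_distr[symmetric])
    moreover have "x \<otimes> e = e \<otimes> (x \<otimes> e) \<oplus> k \<otimes> (x \<otimes> e)"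
      using k ec kc x by (simp add: l_distr[symmetric])
    ultimately show ?thesis using ec x by simp
  qed
  then show ?thesis using ec unfolding central_def by blast
qed

section \<open>From unique cleanness to congruence modulo the radical\<close>

lemma (in ring) uniquely_clean_minus_in_jacobson_radical:
  assumes abel: "\<And>f. f \<in> idempotents R \<Longrightarrow> central R f"
    and pi: "uniquely_pi_clean R"
    and uc: "uniquely_clean R x" and e: "e \<in> idempotents R" and u: "u \<in> Units R" and x: "x = e \<oplus> u"
  shows "x \<ominus> (\<one> \<ominus> e) \<in> jacobson_radical R"
proof -
  define e' where "e' = \<one> \<ominus> e"
  define d where "d = x \<ominus> e'"
  have ec: "e \<in> carrier R" and uR: "u \<in> carrier R" and e'c: "e' \<in> carrier R"
    using e u by (auto simp: idempotents_def e'_def)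
  have xc: "x \<in> carrier R" and dc: "d \<in> carrier R" using x ec uR e'c by (auto simp: d_def)
  have e': "e' \<in> idempotents R" using one_minus_idempotent[OF e] by (simp add: e'_def)
  have xd: "x = e' \<oplus> d"
    using xc e'c by (simp add: d_def a_minus_def a_ac r_neg1 r_neg2 add_cancel_middle)
  have "\<exists>t\<in>carrier R. t \<otimes> (\<one> \<ominus> r \<otimes> d) = \<one>" if r: "r \<in> carrier R" for r
  proof -
    define y where "y = \<one> \<ominus> r \<otimes> d"
    have y: "y \<in> carrier R" using r dc by (simp add: y_def)
    obtain n :: nat where n: "n > 0" "uniquely_clean R (y [^] n)"
      using pi y unfolding uniquely_pi_clean_def by blast
    then obtain g w where g: "g \<in> idempotents R" and w: "w \<in> Units R" and yn: "y [^] n = g \<oplus> w"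
      unfolding uniquely_clean_def by (metis mem_Times_iff)
    note gcen = abel[OF g]
    define k where "k = \<one> \<ominus> g"
    have gc: "g \<in> carrier R" and gg: "g \<otimes> g = g" and wc: "w \<in> carrier R" and kc: "k \<in> carrier R"
      using g w by (auto simp: idempotents_def k_def)
    note k = one_minus_idempotent[OF g, folded k_def]
    obtain s where s: "s \<in> carrier R" "y [^] n \<ominus> \<one> = s \<otimes> (y \<ominus> \<one>)"
      using power_minus_one_left_multiple[OF y] by blast
    have "y \<ominus> \<one> = \<ominus> (r \<otimes> d)"
      using r dc by (simp add: y_def a_minus_def a_ac r_neg1 r_neg2 add_cancel_middle)
    with s have ys: "y [^] n \<ominus> \<one> = \<ominus> (s \<otimes> r) \<otimes> d"
      using r dc by (simp add: r_minus l_minus m_assoc)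
    \<comment> \<open>Since \<open>g\<close> is idempotent, \<open>(g + w - 1) g = w g\<close>. This
      makes \<open>w g\<close> a left multiple of \<open>d g\<close>.\<close>
    have "(y [^] n \<ominus> \<one>) \<otimes> g = w \<otimes> g"
      using gc gg wc by (simp add: yn a_minus_def l_distr l_minus a_ac r_neg1 r_neg2 add_cancel_middle r_neg)
    then have wg: "w \<otimes> g = \<ominus> (s \<otimes> r) \<otimes> d \<otimes> g" by (simp add: ys)
    \<comment> \<open>Cancelling the unit \<open>w\<close> leaves a left inverse \<open>t\<close> of
      \<open>d\<close> on the corner at \<open>g\<close>.\<close>
    define t where "t = inv w \<otimes> \<ominus> (s \<otimes> r)"
    have t: "t \<in> carrier R" using w s r by (simp add: t_def)
    have tdg: "t \<otimes> d \<otimes> g = g"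
    proof -
      have "t \<otimes> d \<otimes> g = inv w \<otimes> (\<ominus> (s \<otimes> r) \<otimes> d \<otimes> g)"
        using w s r dc gc by (simp add: t_def m_assoc)
      also have "\<dots> = (inv w \<otimes> w) \<otimes> g"
        using m_assoc[OF Units_inv_closed[OF w] wc gc] by (simp only: wg)
      finally show ?thesis using w gc by simp
    qed
    \<comment> \<open>The competing decomposition of \<open>x\<close> is \<open>e' + d\<close> on
      the corner at \<open>g\<close> and the original \<open>e + u\<close> on the corner at
      \<open>k\<close>.\<close>
    define f where "f = e' \<otimes> g \<oplus> e \<otimes> k"
    define z where "z = d \<otimes> g \<oplus> u \<otimes> k"
    have fI: "f \<in> idempotents R"
      using corner_mult[OF g gcen e'c e'c ec ec] e e' gc kc
      by (simp add: f_def k_def idempotents_def)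
    have zc: "z \<in> carrier R" using dc gc uR kc by (simp add: z_def)
    have "(t \<otimes> g \<oplus> inv u \<otimes> k) \<otimes> z = \<one>"
      using corner_mult[OF g gcen t dc Units_inv_closed[OF u] uR] u kc
      by (simp add: z_def tdg k k_def[symmetric])
    from left_invertible_imp_unit[OF abel _ zc this] have zU: "z \<in> Units R"
      using t gc kc u by simp
    have "x = x \<otimes> g \<oplus> x \<otimes> k" using corner_split[OF g xc] by (simp add: k_def)
    also have "x \<otimes> g = e' \<otimes> g \<oplus> d \<otimes> g" using xd e'c dc gc by (simp add: l_distr)
    also have "x \<otimes> k = e \<otimes> k \<oplus> u \<otimes> k" using x ec uR kc by (simp add: l_distr)
    finally have "x = f \<oplus> z" using e'c dc gc ec uR kc by (simp add: f_def z_def a_ac)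
    then have ef: "e = f" using uniquely_cleanD[OF uc e u x fI zU] by simp
    \<comment> \<open>Comparing \<open>e\<close> with \<open>f\<close> on the corner at
      \<open>g\<close>, where \<open>f\<close> acts as \<open>e'\<close>.\<close>
    have eg: "e \<otimes> g = e' \<otimes> g"
    proof -
      have "e \<otimes> g = f \<otimes> g" using ef by simp
      also have "\<dots> = e' \<otimes> g" using e'c ec gc kc k gg by (simp add: f_def l_distr m_assoc)
      finally show ?thesis .
    qed
    have "g = (e \<oplus> e') \<otimes> g" using one_minus_idempotent(4)[OF e] gc by (simp add: e'_def)
    also have "\<dots> = e' \<otimes> g \<oplus> e \<otimes> g" using ec e'c gc eg by (simp add: l_distr)
    finally have g2: "g = e' \<otimes> g \<oplus> e \<otimes> g" .
    have ee: "e \<otimes> e' = \<zero>" "e \<otimes> e = e" "e' \<otimes> e = \<zero>" "e' \<otimes> e' = e'"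
      using one_minus_idempotent[OF e] e e' by (auto simp: e'_def idempotents_def)
    \<comment> \<open>Multiplying \<open>e g = e' g\<close> by \<open>e\<close> kills the right
      side, so both summands of \<open>g\<close> vanish.\<close>
    have "e \<otimes> g = e \<otimes> (e \<otimes> g)" using ee ec gc by (simp add: m_assoc[symmetric])
    also have "\<dots> = (e \<otimes> e') \<otimes> g" using eg ec e'c gc by (simp add: m_assoc)
    finally have "e \<otimes> g = \<zero>" using ee gc by simp
    moreover from this have "e' \<otimes> g = \<zero>" by (simp only: eg)
    ultimately have "g = \<zero>" using g2 by simp
    then have "y [^] n = w" using yn wc by simp
    \<comment> \<open>Positivity of \<open>n\<close> lets one factor \<open>y\<close> be split off
      on the right of the unit \<open>y^n\<close>.\<close>
    moreover obtain l where "n = Suc l" using n(1) gr0_implies_Suc by blast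
    ultimately have "inv w \<otimes> (y [^] l \<otimes> y) = \<one>" using w by simp
    then have "(inv w \<otimes> y [^] l) \<otimes> y = \<one>" using w y by (simp add: m_assoc)
    then show ?thesis unfolding y_def[symmetric]
      using w y by (intro bexI[of _ "inv w \<otimes> y [^] l"]) simp_all
  qed
  then show ?thesis using dc unfolding jacobson_radical_iff d_def e'_def by blast
qed

section \<open>From congruence modulo the radical back to unique cleanness\<close>

text \<open>The difference \<open>x\<close> of two commuting idempotents satisfies
  \<open>x^3 = x\<close>. So \<open>x^2\<close> is an idempotent left multiple of a radical element,
  hence zero, and then \<open>x = x^3\<close> is zero too.\<close>

lemma (in ring) idempotent_eq_if_congruent_central:
  assumes e: "e \<in> idempotents R" "central R e" and f: "f \<in> idempotents R"
    and j: "f \<ominus> e \<in> jacobson_radical R"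
  shows "f = e"
proof -
  define x where "x = f \<ominus> e"
  have ec: "e \<in> carrier R" "e \<otimes> e = e" and fc: "f \<in> carrier R" "f \<otimes> f = f"
    using e f by (auto simp: idempotents_def)
  have ef: "f \<otimes> e = e \<otimes> f" using e fc by (simp add: central_def)
  have efl: "e \<otimes> (e \<otimes> v) = e \<otimes> v" "f \<otimes> (f \<otimes> v) = f \<otimes> v" "f \<otimes> (e \<otimes> v) = e \<otimes> (f \<otimes> v)"
    if "v \<in> carrier R" for v
    using ec fc ef that by (simp_all add: m_assoc[symmetric])
  have xc: "x \<in> carrier R" using ec fc by (simp add: x_def)
  have "x \<otimes> x \<in> idempotents R" unfolding idempotents_def x_def
    using ec fc by (simp add: ef efl a_minus_def l_distr r_distr l_minus r_minus m_assoc minus_add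
      a_ac r_neg1 r_neg2 add_cancel_middle r_neg)
  then have xx: "x \<otimes> x = \<zero>"
    using idempotent_in_jacobson_radical j xc x_def by blast
  have "x = x \<otimes> x \<otimes> x" unfolding x_def
    using ec fc by (simp add: ef efl a_minus_def l_distr r_distr l_minus r_minus m_assoc minus_add
      a_ac r_neg1 r_neg2 add_cancel_middle r_neg)
  with xx xc have "x = \<zero>" by simp
  moreover have "f = x \<oplus> e" using ec fc by (simp add: x_def a_minus_def a_assoc l_neg)
  ultimately show ?thesis using ec by simp
qed

lemma (in ring) uniquely_clean_if_minus_idempotent_in_jacobson_radical:
  assumes abel: "\<And>f. f \<in> idempotents R \<Longrightarrow> central R f"
    and x: "x \<in> carrier R" and e: "e \<in> idempotents R" and j: "x \<ominus> e \<in> jacobson_radical R"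
  shows "uniquely_clean R x"
proof -
  define k where "k = \<one> \<ominus> e"
  note k = one_minus_idempotent[OF e, folded k_def]
  have ec: "e \<in> carrier R" "e \<otimes> e = e" and kc: "k \<in> carrier R" "k \<otimes> k = k"
    using e k by (auto simp: idempotents_def)
  \<comment> \<open>This is \<open>2 e - 1\<close>, a square root of 1; \<open>v\<close> differs
    from it by the radical element \<open>x - e\<close>.\<close>
  define s where "s = e \<ominus> k"
  define v where "v = x \<ominus> k"
  have sc: "s \<in> carrier R" and vc: "v \<in> carrier R" using ec kc x by (auto simp: s_def v_def)
  have ss: "s \<otimes> s = \<one>"
    using ec kc k by (simp add: s_def a_minus_def l_distr r_distr l_minus r_minus)
  have v: "v = s \<oplus> (x \<ominus> e)"
    using ec kc x by (simp add: s_def v_def a_minus_def a_ac r_neg1 r_neg2 add_cancel_middle)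
  \<comment> \<open>The multiplier \<open>-s\<close> is chosen so that the left invertible element
    \<open>1 + s (x - e)\<close> equals \<open>s v\<close>.\<close>
  obtain t where t: "t \<in> carrier R" "t \<otimes> (\<one> \<ominus> \<ominus> s \<otimes> (x \<ominus> e)) = \<one>"
    using j sc unfolding jacobson_radical_iff by blast
  have "\<one> \<ominus> \<ominus> s \<otimes> (x \<ominus> e) = s \<otimes> v"
    using sc ss ec x by (simp add: v r_distr a_minus_def[of _ \<one>] l_minus)
  then have "(t \<otimes> s) \<otimes> v = \<one>" using t sc vc by (simp add: m_assoc)
  then have vU: "v \<in> Units R" using left_invertible_imp_unit[OF abel _ vc] t sc by blast
  have xv: "x = k \<oplus> v" using kc x by (simp add: v_def a_minus_def a_ac r_neg1 r_neg2 add_cancel_middle)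
  have uniq: "f = k \<and> u = v"
    if f: "f \<in> idempotents R" and u: "u \<in> Units R" and xf: "x = f \<oplus> u" for f u
  proof -
    define l where "l = \<one> \<ominus> f"
    note l = one_minus_idempotent[OF f, folded l_def]
    have fc: "f \<in> carrier R" "f \<otimes> f = f" and lc: "l \<in> carrier R" "l \<otimes> l = l"
      and uc: "u \<in> carrier R"
      using f l u by (auto simp: idempotents_def)
    \<comment> \<open>Where \<open>e\<close> and \<open>f\<close> act alike on
      \<open>h = p q\<close>, so do \<open>x - e\<close> and \<open>x - f = u\<close>. Hence
      \<open>u h = h (x - e)\<close>, and \<open>h\<close> is an idempotent left multiple of a
      radical element.\<close>
    have prod: "p \<otimes> q = \<zero>" if p: "p \<in> idempotents R" and q: "q \<in> idempotents R"
        and epq: "e \<otimes> (p \<otimes> q) = f \<otimes> (p \<otimes> q)" for p q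
    proof -
      have pc: "p \<in> carrier R" "p \<otimes> p = p" and qc: "q \<in> carrier R" "q \<otimes> q = q"
        using p q by (auto simp: idempotents_def)
      have hc: "p \<otimes> q \<in> carrier R" using pc qc by simp
      have "p \<otimes> q \<otimes> (p \<otimes> q) = p \<otimes> (q \<otimes> p) \<otimes> q" using pc qc by (simp add: m_assoc)
      also have "q \<otimes> p = p \<otimes> q" using abel[OF p] qc by (simp add: central_def)
      also have "p \<otimes> (p \<otimes> q) \<otimes> q = (p \<otimes> p) \<otimes> (q \<otimes> q)" using pc(1) qc(1) by (simp add: m_assoc)
      finally have h: "p \<otimes> q \<in> idempotents R" using pc qc by (simp add: idempotents_def)
      have "u \<otimes> (p \<otimes> q) = (x \<ominus> f) \<otimes> (p \<otimes> q)"
        using xf fc uc by (simp add: a_minus_def a_ac r_neg1 r_neg2 add_cancel_middle)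
      also have "\<dots> = (x \<ominus> e) \<otimes> (p \<otimes> q)"
        using x fc ec hc epq by (simp add: a_minus_def l_distr l_minus)
      also have "\<dots> = (p \<otimes> q) \<otimes> (x \<ominus> e)" using abel[OF h] x ec by (simp add: central_def)
      finally have "inv u \<otimes> (u \<otimes> (p \<otimes> q)) = inv u \<otimes> ((p \<otimes> q) \<otimes> (x \<ominus> e))" by simp
      moreover have "inv u \<otimes> (u \<otimes> (p \<otimes> q)) = p \<otimes> q"
        using u uc hc by (simp add: m_assoc[symmetric])
      ultimately have pq: "p \<otimes> q = (inv u \<otimes> (p \<otimes> q)) \<otimes> (x \<ominus> e)"
        using u hc x ec by (simp add: m_assoc)
      show ?thesis
        using u hc by (intro idempotent_in_jacobson_radical[OF h j _ pq]) simp
    qed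
    have ef: "e \<otimes> f = f \<otimes> e" using abel[OF e] fc by (simp add: central_def)
    have "e \<otimes> (e \<otimes> f) = e \<otimes> f" using ec fc by (simp add: m_assoc[symmetric])
    moreover have "f \<otimes> (e \<otimes> f) = e \<otimes> f" using ec fc by (simp add: ef m_assoc[symmetric])
    ultimately have "e \<otimes> f = \<zero>" by (intro prod[OF e f]) simp
    \<comment> \<open>Both \<open>e\<close> and \<open>f\<close> annihilate \<open>k l\<close>,
      whereas both act as the identity on \<open>e f\<close>.\<close>
    moreover have "k \<otimes> l = \<zero>"
    proof (rule prod[OF k(1) l(1)])
      have "e \<otimes> (k \<otimes> l) = \<zero>" using ec kc lc k by (simp add: m_assoc[symmetric])
      moreover have "f \<otimes> k = k \<otimes> f" using abel[OF f] kc by (simp add: central_def)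
      then have "f \<otimes> (k \<otimes> l) = (k \<otimes> f) \<otimes> l"
        using fc kc lc by (simp add: m_assoc[symmetric])
      moreover have "(k \<otimes> f) \<otimes> l = \<zero>" using fc kc lc l by (simp add: m_assoc)
      ultimately show "e \<otimes> (k \<otimes> l) = f \<otimes> (k \<otimes> l)" by simp
    qed
    \<comment> \<open>With \<open>e f\<close> and \<open>k l\<close> zero, both \<open>f\<close> and
      \<open>k\<close> reduce to \<open>k f\<close>.\<close>
    moreover have "e \<otimes> f \<oplus> k \<otimes> f = f"
      using k ec kc fc by (simp add: l_distr[symmetric])
    moreover have "k \<otimes> f \<oplus> k \<otimes> l = k"
      using l kc fc lc by (simp add: r_distr[symmetric])
    ultimately have "f = k" using kc fc by simp
    moreover from this have "u = v" using xf xv kc uc vc by simp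
    ultimately show ?thesis by simp
  qed
  have "\<exists>!p. p \<in> idempotents R \<times> Units R \<and> x = fst p \<oplus> snd p"
  proof (rule ex1I)
    show "(k, v) \<in> idempotents R \<times> Units R \<and> x = fst (k, v) \<oplus> snd (k, v)"
      using k(1) vU xv by simp
    show "p = (k, v)" if "p \<in> idempotents R \<times> Units R \<and> x = fst p \<oplus> snd p" for p
      using that uniq[of "fst p" "snd p"] by (simp add: mem_Times_iff prod_eq_iff)
  qed
  with x show ?thesis by (simp add: uniquely_clean_def)
qed

theorem theorem2p8:
  fixes R :: "('a, 'b) ring_scheme" (structure)
  assumes "ring R"
  shows "uniquely_pi_clean R \<longleftrightarrow>
    (\<forall>a \<in> carrier R. \<exists>m::nat. m > 0 \<and>
      (\<exists>e \<in> idempotents R. central R e \<and> a [^] m \<ominus> e \<in> jacobson_radical R))"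
proof
  interpret ring R by fact
  assume pi: "uniquely_pi_clean R"
  \<comment> \<open>A positive power of an idempotent is the idempotent itself, so each idempotent
    is uniquely clean.\<close>
  have abel: "central R f" if f: "f \<in> idempotents R" for f
  proof -
    have "f \<in> carrier R" using f by (simp add: idempotents_def)
    then obtain n :: nat where "n > 0" "uniquely_clean R (f [^] n)"
      using pi unfolding uniquely_pi_clean_def by blast
    then show ?thesis
      using uniquely_clean_idempotent_central[OF f] idempotent_nat_pow[OF f] by simp
  qed
  show "\<forall>a \<in> carrier R. \<exists>m::nat. m > 0 \<and>
      (\<exists>e \<in> idempotents R. central R e \<and> a [^] m \<ominus> e \<in> jacobson_radical R)"
  proof
    fix a assume "a \<in> carrier R"
    then obtain n :: nat where n: "n > 0" "uniquely_clean R (a [^] n)"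
      using pi unfolding uniquely_pi_clean_def by blast
    then obtain e u where eu: "e \<in> idempotents R" "u \<in> Units R" "a [^] n = e \<oplus> u"
      unfolding uniquely_clean_def by (metis mem_Times_iff)
    have "a [^] n \<ominus> (\<one> \<ominus> e) \<in> jacobson_radical R"
      by (rule uniquely_clean_minus_in_jacobson_radical[OF abel pi n(2) eu])
    then show "\<exists>m::nat. m > 0 \<and>
        (\<exists>e \<in> idempotents R. central R e \<and> a [^] m \<ominus> e \<in> jacobson_radical R)"
      using n(1) one_minus_idempotent(1)[OF eu(1)] abel[OF one_minus_idempotent(1)[OF eu(1)]]
      by (intro exI[of _ n] conjI bexI[of _ "\<one> \<ominus> e"])
  qed
next
  interpret ring R by fact
  assume *: "\<forall>a \<in> carrier R. \<exists>m::nat. m > 0 \<and>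
      (\<exists>e \<in> idempotents R. central R e \<and> a [^] m \<ominus> e \<in> jacobson_radical R)"
  \<comment> \<open>Again \<open>f^m = f\<close>, so each idempotent is congruent to a central one
    modulo the radical and equals it.\<close>
  have abel: "central R f" if f: "f \<in> idempotents R" for f
  proof -
    have "f \<in> carrier R" using f by (simp add: idempotents_def)
    then obtain m :: nat and e where "m > 0" "e \<in> idempotents R" "central R e"
      "f [^] m \<ominus> e \<in> jacobson_radical R"
      using * by blast
    then show ?thesis
      using idempotent_eq_if_congruent_central[of e f] idempotent_nat_pow[OF f] f by simp
  qed
  show "uniquely_pi_clean R"
    unfolding uniquely_pi_clean_def
    using * uniquely_clean_if_minus_idempotent_in_jacobson_radical[OF abel] by (meson nat_pow_closed)
qed

end
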